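(* Let $r,d,g$ be integers with $d \geq 2$ and $r,g \geq 3$. There exists an $r$-uniform, $d$-regular hypergraph with girth at least $g$, and at most $$(r-1)\left(1+d(r-1)\frac{(d-1)^g (r-1)^g -1}{(d-1)(r-1)-1}\right) < 4((d-1)(r-1))^{g+1}$$ vertices. Hence, $$n_r(g,d) < 4((d-1)(r-1))^{g+1}.$$
   Context: A hypergraph $H$ is a pair of finite sets $(V(H),E(H))$, where $V(H)$ (the vertices) is non-empty and $E(H)$ (the edges) is a family of distinct subsets of $V(H)$. It is $r$-uniform if all its edges have size $r$, and $d$-regular if each vertex is contained in exactly $d$ edges. A hypergraph is a (Berge) cycle of length $l$ if it has exactly $l\ge 2$ edges and there is a cyclic ordering $(e_1,\ldots,e_l)$ of its (distinct) edges such that there exist distinct vertices $v_1,\ldots,v_l$ with $v_i\in e_i\cap e_{i+1}$ for all $i$, where $e_{l+1}:=e_1$. The girth of a hypergraph $H$ is the length of the shortest cycle it contains, i.e. the least $l$ such that some $l$ edges of $H$ form a cycle ($\infty$ if there is none). For integers $d\ge 2$ and $r,g\ge 3$, $n_r(g,d)$ denotes the minimum possible number of vertices in an $r$-uniform, $d$-regular hypergraph with girth at least $g$. *)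

theory Defs
  imports Complex_Main "HOL-Library.Extended_Nat"
begin

type_synonym 'a hypergraph = "'a set \<times> 'a set set"

abbreviation hverts :: "'a hypergraph \<Rightarrow> 'a set" where
  "hverts H \<equiv> fst H"

abbreviation hedges :: "'a hypergraph \<Rightarrow> 'a set set" where
  "hedges H \<equiv> snd H"

definition hypergraph :: "'a hypergraph \<Rightarrow> bool" where
  "hypergraph H \<longleftrightarrow> finite (hverts H) \<and> hverts H \<noteq> {} \<and> hedges H \<subseteq> Pow (hverts H)"

definition uniform_hypergraph :: "nat \<Rightarrow> 'a hypergraph \<Rightarrow> bool" where
  "uniform_hypergraph r H \<longleftrightarrow> (\<forall>e\<in>hedges H. card e = r)"

definition regular_hypergraph :: "nat \<Rightarrow> 'a hypergraph \<Rightarrow> bool" where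
  "regular_hypergraph d H \<longleftrightarrow> (\<forall>v\<in>hverts H. card {e\<in>hedges H. v \<in> e} = d)"

(* The cyclic ordering is e 0, ..., e (l - 1), with indices read modulo l. *)
definition berge_cycle :: "nat \<Rightarrow> 'a hypergraph \<Rightarrow> bool" where
  "berge_cycle l H \<longleftrightarrow> hypergraph H \<and> l \<ge> 2 \<and>
     (\<exists>e v. bij_betw e {..<l} (hedges H) \<and> inj_on v {..<l} \<and>
            (\<forall>i<l. v i \<in> e i \<inter> e (Suc i mod l)))"

(* The infimum of the empty set in enat is \<infinity>. *)
definition girth :: "'a hypergraph \<Rightarrow> enat" where
  "girth H = Inf {enat l | l F. F \<subseteq> hedges H \<and> berge_cycle l (hverts H, F)}"

(* n_r(g,d). Vertex sets are finite, so up to isomorphism it is enough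
   to consider hypergraphs whose vertices are natural numbers. *)
definition min_order :: "nat \<Rightarrow> nat \<Rightarrow> nat \<Rightarrow> nat" where
  "min_order r g d = (LEAST n. \<exists>H :: nat hypergraph.
     hypergraph H \<and> uniform_hypergraph r H \<and> regular_hypergraph d H \<and> enat g \<le> girth H \<and> card (hverts H) = n)"

end

(* Take a regular uniform hypergraph of girth at least g with the fewest vertices. If it had more
   vertices than r - 1 balls of radius g can cover, one could choose r vertices pairwise at distance
   more than g, delete them together with their edges, and restore the degrees of their neighbours
   by d(r - 1) disjoint new edges, each with one neighbour of every deleted vertex. The girth stays at
   least g: a stretch of old edges between two new ones that joins neighbours of different deleted
   vertices has length at least g - 1, and one that joins neighbours of the same deleted vertex
   closes up through that vertex to an old cycle that is longer by at most 2.
   That such hypergraphs exist at all follows from a permutation group generated by d elements of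
   order r in which no reduced word of length at most g is trivial: the edges are the left cosets
   of the d cyclic subgroups, and a short cycle would spell a trivial reduced word. *)

theory Submission
  imports Defs "HOL-Combinatorics.Permutations"
begin

section \<open>Cycles and nonbacktracking walks\<close>

text \<open>A Berge cycle inside the family \<open>E\<close>. The subfamily over which
  \<open>girth\<close> ranges is not named: it is the image of \<open>e\<close>.\<close>

definition cycle :: "'a set set \<Rightarrow> nat \<Rightarrow> (nat \<Rightarrow> 'a set) \<Rightarrow> (nat \<Rightarrow> 'a) \<Rightarrow> bool" where
  "cycle E l e v \<longleftrightarrow> 2 \<le> l \<and> inj_on e {..<l} \<and> e ` {..<l} \<subseteq> E \<and> inj_on v {..<l} \<and>
     (\<forall>i<l. v i \<in> e i \<inter> e (Suc i mod l))"

lemma girth_ge_iff: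
  assumes "hypergraph H"
  shows "enat g \<le> girth H \<longleftrightarrow> (\<forall>l e v. cycle (hedges H) l e v \<longrightarrow> g \<le> l)"
proof -
  have "(\<exists>F \<subseteq> hedges H. berge_cycle l (hverts H, F)) \<longleftrightarrow> (\<exists>e v. cycle (hedges H) l e v)"
    (is "?L \<longleftrightarrow> ?R") for l
  proof
    assume ?L
    then obtain F e v where F: "F \<subseteq> hedges H" "2 \<le> l" "bij_betw e {..<l} F" "inj_on v {..<l}"
      "\<forall>i<l. v i \<in> e i \<inter> e (Suc i mod l)"
      unfolding berge_cycle_def snd_conv by blast
    then have "cycle (hedges H) l e v"
      unfolding cycle_def bij_betw_def by blast
    then show ?R by blast
  next
    assume ?R
    then obtain e v where C: "cycle (hedges H) l e v" by blast
    then have sub: "e ` {..<l} \<subseteq> hedges H" by (simp add: cycle_def)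
    moreover have "hypergraph (hverts H, e ` {..<l})"
      using assms subset_trans[OF sub] by (simp add: hypergraph_def)
    moreover have "bij_betw e {..<l} (e ` {..<l})"
      using C by (simp add: cycle_def bij_betw_def)
    ultimately have "berge_cycle l (hverts H, e ` {..<l})"
      using C unfolding berge_cycle_def cycle_def snd_conv by blast
    then show ?L using sub by blast
  qed
  then have "{enat l | l F. F \<subseteq> hedges H \<and> berge_cycle l (hverts H, F)} =
      {enat l | l. \<exists>e v. cycle (hedges H) l e v}"
    by blast
  then have "girth H = Inf {enat l | l. \<exists>e v. cycle (hedges H) l e v}"
    by (simp add: girth_def)
  then show ?thesis
    by (simp only: le_Inf_iff) (simp only: Ball_def mem_Collect_eq, use enat_ord_simps(1) in blast)
qed

text \<open>Lets a cycle that uses a prescribed edge be read as starting with that edge.\<close>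

lemma cycle_rotate:
  assumes "cycle E l e v"
  shows "cycle E l (\<lambda>i. e ((i + k) mod l)) (\<lambda>i. v ((i + k) mod l))"
proof -
  have l: "l \<ge> 2" using assms by (simp add: cycle_def)
  have inj: "inj_on (\<lambda>i. (i + k) mod l) {..<l}"
  proof (rule inj_onI)
    fix i j assume "i \<in> {..<l}" "j \<in> {..<l}" and eq: "(i + k) mod l = (j + k) mod l"
    then have "i < l" "j < l" by auto
    have "int i mod int l = int j mod int l"
      using eq by (metis add_diff_cancel_right' mod_diff_left_eq of_nat_add of_nat_mod)
    then show "i = j" using \<open>i < l\<close> \<open>j < l\<close> by simp
  qed
  have sub: "(\<lambda>i. (i + k) mod l) ` {..<l} \<subseteq> {..<l}" using l by auto
  have S: "(Suc i mod l + k) mod l = Suc ((i + k) mod l) mod l" for i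
    by (simp add: mod_simps)
  show ?thesis
    unfolding cycle_def
  proof (intro conjI allI impI)
    show "inj_on (\<lambda>i. e ((i + k) mod l)) {..<l}"
      using comp_inj_on[OF inj, of e] assms inj_on_subset[OF _ sub] by (auto simp: cycle_def o_def)
    show "inj_on (\<lambda>i. v ((i + k) mod l)) {..<l}"
      using comp_inj_on[OF inj, of v] assms inj_on_subset[OF _ sub] by (auto simp: cycle_def o_def)
    show "(\<lambda>i. e ((i + k) mod l)) ` {..<l} \<subseteq> E"
      using assms l by (auto simp: cycle_def image_subset_iff)
    fix i assume "i < l"
    then have "v ((i + k) mod l) \<in> e ((i + k) mod l) \<inter> e (Suc ((i + k) mod l) mod l)"
      using assms l by (simp add: cycle_def)
    then show "v ((i + k) mod l) \<in> e ((i + k) mod l) \<inter> e ((Suc i mod l + k) mod l)"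
      by (simp only: S)
  qed (use l in simp)
qed

lemma cycle_image:
  assumes "cycle E l e v" "inj_on f V" "E \<subseteq> Pow V"
  shows "cycle ((`) f ` E) l (\<lambda>i. f ` e i) (\<lambda>i. f (v i))"
proof -
  have eE: "e i \<in> E" if "i < l" for i
    using assms(1) that by (auto simp: cycle_def)
  have vV: "v i \<in> V" if "i < l" for i
    using eE[OF that] assms(1,3) that by (auto simp: cycle_def)
  have "inj_on (\<lambda>i. f ` e i) {..<l}"
  proof (rule inj_onI)
    fix i j assume ij: "i \<in> {..<l}" "j \<in> {..<l}" "f ` e i = f ` e j"
    then have "e i = e j"
      using eE assms(2,3) by (metis PowD inj_on_image_eq_iff lessThan_iff subsetD)
    then show "i = j" using assms(1) ij by (auto simp: cycle_def dest: inj_onD)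
  qed
  moreover have "inj_on (\<lambda>i. f (v i)) {..<l}"
    using assms(1,2) vV by (auto simp: cycle_def inj_on_def)
  ultimately show ?thesis
    using assms(1) eE unfolding cycle_def by auto
qed

text \<open>A walk may start and end with the same edge, even if it is closed.\<close>

definition nbwalk :: "'a set set \<Rightarrow> nat \<Rightarrow> (nat \<Rightarrow> 'a) \<Rightarrow> (nat \<Rightarrow> 'a set) \<Rightarrow> bool" where
  "nbwalk E m x e \<longleftrightarrow>
     (\<forall>i<m. e i \<in> E \<and> x i \<in> e i \<and> x (Suc i) \<in> e i \<and> x i \<noteq> x (Suc i)) \<and>
     (\<forall>i. Suc i < m \<longrightarrow> e i \<noteq> e (Suc i))"

lemma nbwalk_drop:
  assumes "nbwalk E m x e" "i + n \<le> m"
  shows "nbwalk E n (\<lambda>t. x (i + t)) (\<lambda>t. e (i + t))"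
  using assms by (auto simp: nbwalk_def)

text \<open>As \<open>v i\<close> lies in the edges numbered \<open>i\<close> and
  \<open>i + 1\<close>, the step from \<open>v i\<close> to \<open>v (i + 1)\<close> runs along edge
  \<open>i + 1\<close>. This explains the shift in the indices of \<open>e\<close>.\<close>

lemma cycle_imp_nbwalk:
  assumes "cycle E l e v"
  shows "nbwalk E l (\<lambda>t. v (t mod l)) (\<lambda>t. e (Suc t mod l))"
proof -
  have l: "2 \<le> l" and ie: "inj_on e {..<l}" and iv: "inj_on v {..<l}"
    and eE: "\<And>i. i < l \<Longrightarrow> e i \<in> E" and v: "\<And>i. i < l \<Longrightarrow> v i \<in> e i \<inter> e (Suc i mod l)"
    using assms by (auto simp: cycle_def)
  have ne: "t mod l \<noteq> Suc t mod l" for t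
    using l by (simp add: mod_Suc)
  have lt: "t mod l < l" for t using l by simp
  show ?thesis
    unfolding nbwalk_def
  proof (intro conjI allI impI)
    fix i assume "i < l"
    show "e (Suc i mod l) \<in> E" using eE lt by blast
    show "v (i mod l) \<in> e (Suc i mod l)" using v[of i] \<open>i < l\<close> by simp
    show "v (Suc i mod l) \<in> e (Suc i mod l)" using v[OF lt, of "Suc i"] by simp
    show "v (i mod l) \<noteq> v (Suc i mod l)"
      using inj_onD[OF iv, of "i mod l" "Suc i mod l"] ne lt by auto
  next
    fix i
    show "e (Suc i mod l) \<noteq> e (Suc (Suc i) mod l)"
      using inj_onD[OF ie, of "Suc i mod l" "Suc (Suc i) mod l"] ne lt by auto
  qed
qed

text \<open>A closed walk that admits no shorter one is a cycle. A repeated vertex would cut off a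
  shorter closed walk, and a repeated edge would give a shortcut back to a vertex visited
  earlier.\<close>

lemma closed_nbwalk_imp_cycle:
  assumes "nbwalk E m x e" "0 < m" "x m = x 0"
  shows "\<exists>l\<le>m. \<exists>e v. cycle E l e v"
  using assms
proof (induction m arbitrary: x e rule: less_induct)
  case (less m)
  show ?case
  proof (cases "\<exists>n<m. \<exists>x e. nbwalk E n x e \<and> 0 < n \<and> x n = x 0")
    case True
    then obtain n x e where "n < m" "nbwalk E n x e" "0 < n" "x n = x 0" by blast
    moreover from this obtain l e v where "l \<le> n" "cycle E l e v" using less.IH by blast
    ultimately show ?thesis by (meson less_imp_le le_trans)
  next
    case False
    have W: "e i \<in> E" "x i \<in> e i" "x (Suc i) \<in> e i" "x i \<noteq> x (Suc i)" if "i < m" for i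
      using less.prems(1) that by (auto simp: nbwalk_def)
    have ix: "x i \<noteq> x j" if "i < j" "j < m" for i j
    proof
      assume "x i = x j"
      then have "nbwalk E (j - i) (\<lambda>t. x (i + t)) (\<lambda>t. e (i + t)) \<and> 0 < j - i \<and>
          (\<lambda>t. x (i + t)) (j - i) = (\<lambda>t. x (i + t)) 0"
        using nbwalk_drop[OF less.prems(1), of i "j - i"] that by auto
      moreover have "j - i < m" using that by linarith
      ultimately show False using False by blast
    qed
    have ie: "e i \<noteq> e j" if "i < j" "j < m" for i j
    proof
      assume eq: "e i = e j"
      have j: "Suc i < j"
        using less.prems(1) eq that unfolding nbwalk_def by (metis Suc_lessI)
      \<comment> \<open>The shortcut: walk from \<open>x (Suc i)\<close> to \<open>x j\<close> as
        before, then return along \<open>e j = e i\<close>, which contains \<open>x (Suc i)\<close>.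
        The result is closed of length \<open>j - i < m\<close>.\<close>
      define y where "y t = (if t = j - i then x (Suc i) else x (Suc i + t))" for t
      have "nbwalk E (j - i) y (\<lambda>t. e (Suc i + t))"
        unfolding nbwalk_def
      proof (intro conjI allI impI)
        fix t assume t: "t < j - i"
        show "e (Suc i + t) \<in> E" using W t that by auto
        show "y t \<in> e (Suc i + t)" using W(2)[of "Suc i + t"] t that by (auto simp: y_def)
        have "t = j - Suc i \<or> Suc t < j - i" using t by linarith
        then show "y (Suc t) \<in> e (Suc i + t)"
        proof
          assume "t = j - Suc i"
          then have "Suc i + t = j" "Suc t = j - i" using j by linarith+
          then show ?thesis using eq W(3)[of i] that by (simp add: y_def)
        next
          assume "Suc t < j - i"
          then show ?thesis using W(3)[of "Suc i + t"] t that by (auto simp: y_def)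
        qed
        show "y t \<noteq> y (Suc t)"
        proof (cases "Suc t = j - i")
          case True
          then have "Suc i + t = j" by linarith
          then show ?thesis using True ix[of "Suc i" j] j that by (auto simp: y_def)
        next
          case False
          then show ?thesis using W(4)[of "Suc i + t"] t that by (auto simp: y_def)
        qed
      next
        fix t assume "Suc t < j - i"
        then show "e (Suc i + t) \<noteq> e (Suc i + Suc t)"
          using less.prems(1) that by (simp add: nbwalk_def)
      qed
      moreover have "0 < j - i" "y (j - i) = y 0" using that by (auto simp: y_def)
      moreover have "j - i < m" using that by linarith
      ultimately show False using False by blast
    qed
    have m2: "2 \<le> m"
      using W(4)[of 0] less.prems by (cases "m = 1") auto
    have "cycle E m (\<lambda>i. e i) (\<lambda>i. x (Suc i mod m))"
      unfolding cycle_def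
    proof (intro conjI allI impI)
      have inj_x: "inj_on x {..<m}" using ix by (intro linorder_inj_onI) auto
      have "inj_on (\<lambda>i. Suc i mod m) {..<m}"
        by (auto simp: inj_on_def mod_Suc split: if_splits)
      then have "inj_on (x \<circ> (\<lambda>i. Suc i mod m)) {..<m}"
        using less.prems(2) by (intro comp_inj_on inj_on_subset[OF inj_x]) auto
      then show "inj_on (\<lambda>i. x (Suc i mod m)) {..<m}" by (simp add: o_def)
      show "inj_on e {..<m}" using ie by (intro linorder_inj_onI) auto
      fix i assume i: "i < m"
      have "x (Suc i mod m) = x (Suc i)" using i less.prems(3) by (cases "Suc i = m") auto
      then show "x (Suc i mod m) \<in> e i \<inter> e (Suc i mod m)"
        using W(3)[OF i] W(2)[of "Suc i mod m"] i by simp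
    next
      show "e ` {..<m} \<subseteq> E" using W(1) by auto
    qed (rule m2)
    then show ?thesis by blast
  qed
qed

text \<open>With \<open>girth_geI\<close> this turns a lower bound on the girth into a statement
  about closed walks, which are easier to splice than cycles.\<close>

lemma girth_geD:
  assumes "hypergraph H" "enat g \<le> girth H" "nbwalk (hedges H) m x e" "0 < m" "x m = x 0"
  shows "g \<le> m"
proof -
  obtain l e v where "l \<le> m" "cycle (hedges H) l e v"
    using closed_nbwalk_imp_cycle[OF assms(3-5)] by blast
  moreover have "g \<le> l"
    using girth_ge_iff[OF assms(1)] assms(2) calculation(2) by blast
  ultimately show ?thesis by linarith
qed

lemma girth_geI:
  assumes "hypergraph H"
    and "\<And>m x e. nbwalk (hedges H) m x e \<Longrightarrow> 0 < m \<Longrightarrow> x m = x 0 \<Longrightarrow> g \<le> m"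
  shows "enat g \<le> girth H"
proof -
  have "g \<le> l" if "cycle (hedges H) l e v" for l e v
  proof -
    have "0 < l" using that by (simp add: cycle_def)
    then show ?thesis using assms(2)[OF cycle_imp_nbwalk[OF that]] by simp
  qed
  then show ?thesis using girth_ge_iff[OF assms(1)] by blast
qed

section \<open>Admissible hypergraphs and their injective images\<close>

definition admissible :: "nat \<Rightarrow> nat \<Rightarrow> nat \<Rightarrow> 'a hypergraph \<Rightarrow> bool" where
  "admissible r d g H \<longleftrightarrow>
     hypergraph H \<and> uniform_hypergraph r H \<and> regular_hypergraph d H \<and> enat g \<le> girth H"

text \<open>Moves the hypergraph built on permutations to vertices that are natural numbers. The
  girth survives because a cycle in the image can be pulled back along
  \<open>inv_into V f\<close>.\<close>

lemma admissible_image: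
  assumes "admissible r d g H" "inj_on f (hverts H)"
  shows "admissible r d g (f ` hverts H, (`) f ` hedges H)"
proof -
  obtain V E where H: "H = (V, E)" by (cases H)
  have hyp: "hypergraph (V, E)" and E: "E \<subseteq> Pow V" and fin: "finite V" and ne: "V \<noteq> {}"
    and uni: "\<And>e. e \<in> E \<Longrightarrow> card e = r" and deg: "\<And>v. v \<in> V \<Longrightarrow> card {e\<in>E. v \<in> e} = d"
    and girth: "enat g \<le> girth (V, E)"
    using assms(1) by (auto simp: H admissible_def hypergraph_def uniform_hypergraph_def regular_hypergraph_def)
  have inj: "inj_on f V" using assms(2) by (simp add: H)
  have hyp': "hypergraph (f ` V, (`) f ` E)"
    using E fin ne by (auto simp: hypergraph_def)
  have "card (f ` e) = r" if "e \<in> E" for e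
    using uni[OF that] E that card_image[OF inj_on_subset[OF inj]] by auto
  moreover have "card {e \<in> (`) f ` E. f v \<in> e} = d" if "v \<in> V" for v
  proof -
    have "{e \<in> (`) f ` E. f v \<in> e} = (`) f ` {e\<in>E. v \<in> e}"
    proof -
      have "f v \<in> f ` e \<longleftrightarrow> v \<in> e" if "e \<in> E" for e
        using inj_on_image_mem_iff[OF inj \<open>v \<in> V\<close>] E that by auto
      then show ?thesis by auto
    qed
    moreover have "inj_on ((`) f) {e\<in>E. v \<in> e}"
      using E by (intro inj_on_subset[OF inj_on_image_Pow[OF inj]]) auto
    ultimately show ?thesis using deg[OF that] by (simp add: card_image)
  qed
  moreover have "enat g \<le> girth (f ` V, (`) f ` E)"
  proof -
    have "g \<le> l" if "cycle ((`) f ` E) l e v" for l e v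
    proof -
      let ?h = "inv_into V f"
      have "?h ` f ` e = e" if "e \<in> E" for e
        using inv_into_image_cancel[OF inj, of e] E that by auto
      then have "(`) ?h ` (`) f ` E = E" by (simp only: image_image[of "(`) ?h"] cong: image_cong) simp
      moreover have "inj_on ?h (f ` V)" by (simp add: inj_on_inv_into)
      moreover have "(`) f ` E \<subseteq> Pow (f ` V)" using E by auto
      ultimately have "\<exists>e v. cycle E l e v" using cycle_image[OF that, of ?h "f ` V"] by metis
      then show ?thesis using girth girth_ge_iff[OF hyp] by (simp only: snd_conv) blast
    qed
    then show ?thesis using girth_ge_iff[OF hyp'] by (simp only: snd_conv) blast
  qed
  ultimately show ?thesis
    using hyp' by (auto simp: H admissible_def uniform_hypergraph_def regular_hypergraph_def)
qed

section \<open>Existence: short reduced words act nontrivially\<close>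

text \<open>A letter \<^term>\<open>(i, k)\<close> stands for the \<^term>\<open>k\<close>-th power of the \<^term>\<open>i\<close>-th generator
  of the free product of \<^term>\<open>d\<close> cyclic groups of order \<^term>\<open>r\<close>.\<close>

definition words :: "nat \<Rightarrow> nat \<Rightarrow> nat \<Rightarrow> (nat \<times> nat) list set" where
  "words r d g = {w. set w \<subseteq> {..<d} \<times> {1..<r} \<and> length w \<le> g \<and> distinct_adj (map fst w)}"

definition starts :: "nat \<Rightarrow> (nat \<times> nat) list \<Rightarrow> bool" where
  "starts i w \<longleftrightarrow> w \<noteq> [] \<and> fst (hd w) = i"

text \<open>The exponent 0 stands for an absent letter. Hence every word in
  \<open>words r d g\<close> is \<open>push i m u\<close> with \<open>u\<close> not starting with
  generator \<open>i\<close>, whether or not the word itself does.\<close>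

definition push :: "nat \<Rightarrow> nat \<Rightarrow> (nat \<times> nat) list \<Rightarrow> (nat \<times> nat) list" where
  "push i k u = (if k = 0 then u else (i, k) # u)"

definition exponent :: "nat \<Rightarrow> (nat \<times> nat) list \<Rightarrow> nat" where
  "exponent i w = (if starts i w then snd (hd w) else 0)"

definition strip :: "nat \<Rightarrow> (nat \<times> nat) list \<Rightarrow> (nat \<times> nat) list" where
  "strip i w = (if starts i w then tl w else w)"

text \<open>Left multiplication by the letter \<^term>\<open>(i, k)\<close>. Fixing the words that could become
  too long keeps this a permutation of the finite set \<^term>\<open>words r d g\<close>.\<close>

definition act :: "nat \<Rightarrow> nat \<Rightarrow> nat \<Rightarrow> nat \<Rightarrow> nat \<Rightarrow> (nat \<times> nat) list \<Rightarrow> (nat \<times> nat) list" where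
  "act r d g i k w = (if w \<in> words r d g \<and> length (strip i w) < g
     then push i ((exponent i w + k) mod r) (strip i w) else w)"

lemma finite_words: "finite (words r d g)"
proof -
  have "words r d g \<subseteq> {w. set w \<subseteq> {..<d} \<times> {1..<r} \<and> length w \<le> g}"
    by (auto simp: words_def)
  then show ?thesis
    by (rule finite_subset) (intro finite_lists_length_le finite_SigmaI, auto)
qed

lemma Nil_in_words [simp]: "[] \<in> words r d g"
  by (simp add: words_def)

lemma push_in_words:
  assumes "u \<in> words r d g" "\<not> starts i u" "length u < g" "i < d" "k < r"
  shows "push i k u \<in> words r d g"
  using assms by (cases u) (auto simp: words_def starts_def push_def)

lemma exponent_push: "\<not> starts i u \<Longrightarrow> exponent i (push i k u) = k"
  by (auto simp: exponent_def push_def starts_def)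

lemma strip_push: "\<not> starts i u \<Longrightarrow> strip i (push i k u) = u"
  by (auto simp: strip_def push_def starts_def)

lemma push_exponent_strip:
  assumes "w \<in> words r d g"
  shows "push i (exponent i w) (strip i w) = w"
  using assms by (cases w) (auto simp: words_def push_def exponent_def strip_def starts_def)

lemma strip_in_words:
  assumes "w \<in> words r d g"
  shows "strip i w \<in> words r d g"
  using assms by (cases w) (auto simp: words_def strip_def dest: distinct_adj_ConsD)

lemma not_starts_strip:
  assumes "w \<in> words r d g"
  shows "\<not> starts i (strip i w)"
proof (cases w)
  case (Cons a u)
  then show ?thesis
    using assms by (cases u) (auto simp: words_def strip_def starts_def)
qed (simp add: strip_def starts_def)

lemma exponent_less:
  assumes "w \<in> words r d g" "0 < r"
  shows "exponent i w < r"
  using assms by (cases w) (auto simp: words_def exponent_def starts_def)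

lemma act_push:
  assumes "u \<in> words r d g" "\<not> starts i u" "length u < g" "i < d" "m < r"
  shows "act r d g i k (push i m u) = push i ((m + k) mod r) u"
  using push_in_words[OF assms] assms(2,3) by (simp add: act_def exponent_push strip_push)

text \<open>For fixed \<open>u\<close>, the words \<open>push i m u\<close> with
  \<open>m < r\<close> form an orbit on which \<open>act\<close> adds \<open>k\<close> to
  \<open>m\<close> modulo \<open>r\<close>; all other words are fixed. So the powers of generator
  \<open>i\<close> compose by adding exponents.\<close>

lemma act_act:
  assumes "i < d" "0 < r"
  shows "act r d g i k (act r d g i m w) = act r d g i (m + k) w"
proof (cases "w \<in> words r d g \<and> length (strip i w) < g")
  case True
  define u where "u = strip i w"
  have u: "u \<in> words r d g" "\<not> starts i u" "length u < g"
    using True strip_in_words not_starts_strip unfolding u_def by blast+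
  have w: "w = push i (exponent i w) u"
    using push_exponent_strip[of w r d g i] True unfolding u_def by simp
  have e: "exponent i w < r" using exponent_less True assms by blast
  have 1: "act r d g i n w = push i ((exponent i w + n) mod r) u" for n
    using act_push[OF u assms(1) e, of n] w by simp
  show ?thesis
    using act_push[OF u assms(1), of "(exponent i w + m) mod r" k] assms(2)
    by (simp add: 1 mod_add_left_eq add.assoc)
next
  case False
  then have "act r d g i n w = w" for n unfolding act_def by auto
  then show ?thesis by simp
qed

lemma act_0:
  assumes "0 < r"
  shows "act r d g i 0 w = w"
  using push_exponent_strip[of w r d g i] exponent_less[of w r d g i] assms
  by (simp add: act_def)

lemma act_mod: "act r d g i (k mod r) w = act r d g i k w"
  by (simp add: act_def mod_add_right_eq)

lemma act_in_words:
  assumes "i < d" "0 < r" "w \<in> words r d g"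
  shows "act r d g i k w \<in> words r d g"
  using push_in_words[OF strip_in_words[OF assms(3)] not_starts_strip[OF assms(3)]] assms
  by (simp add: act_def)

text \<open>The freeness of the action: below the length limit, a nontrivial power of a new
  generator lengthens the reduced word by one letter.\<close>

lemma act_Cons:
  assumes "w \<in> words r d g" "\<not> starts i w" "length w < g" "i < d" "0 < k" "k < r"
  shows "act r d g i k w = (i, k) # w"
  using act_push[of w r d g i 0 k] assms by (simp add: push_def)

lemma act_permutes:
  assumes "i < d" "0 < r"
  shows "act r d g i k permutes words r d g"
proof (rule bij_imp_permutes)
  \<comment> \<open>The inverse power. Reducing \<open>k\<close> modulo \<open>r\<close> first keeps
    the subtraction of natural numbers from truncating.\<close>
  have inv: "act r d g i (r - k mod r) (act r d g i k w) = w"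
    "act r d g i k (act r d g i (r - k mod r) w) = w" for w
  proof -
    have "(k + (r - k mod r)) mod r = ((r - k mod r) + k) mod r" by (simp add: add.commute)
    also have "\<dots> = ((r - k mod r) + k mod r) mod r" by (simp add: mod_add_right_eq)
    also have "\<dots> = 0" using assms(2) by (simp add: less_imp_le)
    finally have 0: "(k + (r - k mod r)) mod r = 0" .
    then have "act r d g i (k + (r - k mod r)) w = w"
      using act_mod[of r d g i "k + (r - k mod r)" w] act_0[OF assms(2)] by simp
    then show "act r d g i (r - k mod r) (act r d g i k w) = w"
      "act r d g i k (act r d g i (r - k mod r) w) = w"
      by (simp_all only: act_act[OF assms] add.commute)
  qed
  show "bij_betw (act r d g i k) (words r d g) (words r d g)"
    by (rule bij_betw_byWitness[where f' = "act r d g i (r - k mod r)"])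
      (use inv act_in_words[OF assms] in auto)
next
  fix w assume "w \<notin> words r d g"
  then show "act r d g i k w = w" by (simp add: act_def)
qed

section \<open>The hypergraph of left cosets of the cyclic subgroups\<close>

definition perms :: "nat \<Rightarrow> nat \<Rightarrow> nat \<Rightarrow> ((nat \<times> nat) list \<Rightarrow> (nat \<times> nat) list) set" where
  "perms r d g = {p. p permutes words r d g}"

definition coset :: "nat \<Rightarrow> nat \<Rightarrow> nat \<Rightarrow> nat \<Rightarrow> ((nat \<times> nat) list \<Rightarrow> (nat \<times> nat) list) \<Rightarrow>
    ((nat \<times> nat) list \<Rightarrow> (nat \<times> nat) list) set" where
  "coset r d g i p = (\<lambda>k. p \<circ> act r d g i k) ` {..<r}"

text \<open>The base points run over the full symmetric group on the words, which contains the group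
  generated by the actions. The hypergraph therefore splits into copies, one for each left coset of
  that group.\<close>

definition cosets :: "nat \<Rightarrow> nat \<Rightarrow> nat \<Rightarrow> ((nat \<times> nat) list \<Rightarrow> (nat \<times> nat) list) set set" where
  "cosets r d g = (\<Union>i<d. coset r d g i ` perms r d g)"

lemma comp_act_in_coset:
  assumes "0 < r"
  shows "p \<circ> act r d g i k \<in> coset r d g i p"
proof -
  have "p \<circ> act r d g i k = p \<circ> act r d g i (k mod r)"
    by (simp add: fun_eq_iff act_mod)
  then show ?thesis using assms unfolding coset_def by (metis imageI lessThan_iff mod_less_divisor)
qed

lemma self_in_coset:
  assumes "0 < r"
  shows "p \<in> coset r d g i p"
proof -
  have "p \<circ> act r d g i 0 = p" using act_0[OF assms] by (simp add: fun_eq_iff)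
  then show ?thesis using comp_act_in_coset[OF assms] by metis
qed

lemma coset_subset_perms:
  assumes "i < d" "0 < r" "p \<in> perms r d g"
  shows "coset r d g i p \<subseteq> perms r d g"
  using assms act_permutes permutes_compose unfolding coset_def perms_def by blast

text \<open>Cosets of one cyclic subgroup that meet are equal, so an edge can be based at any of its
  vertices.\<close>

lemma coset_eqI:
  assumes "i < d" "0 < r" "q \<in> coset r d g i p"
  shows "coset r d g i q = coset r d g i p"
proof -
  obtain k where k: "k < r" "q = p \<circ> act r d g i k"
    using assms(3) by (auto simp: coset_def)
  have comp: "act r d g i m \<circ> act r d g i n = act r d g i (m + n)" for m n
    using act_act[OF assms(1,2)] by (simp add: fun_eq_iff add.commute)
  have q: "q \<circ> act r d g i m = p \<circ> act r d g i (k + m)" for m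
    by (simp only: k comp o_assoc[symmetric])
  \<comment> \<open>Adding \<open>r - k\<close> undoes the shift by \<open>k\<close>, since
    generator \<open>i\<close> has order dividing \<open>r\<close>.\<close>
  have p: "p \<circ> act r d g i m = q \<circ> act r d g i (r - k + m)" for m
  proof -
    have "k + (r - k + m) = r + m" using k(1) by simp
    moreover have "act r d g i (r + m) = act r d g i m"
      using act_mod[of r d g i "r + m"] act_mod[of r d g i m] by (simp add: fun_eq_iff)
    ultimately show ?thesis by (simp only: q)
  qed
  show ?thesis
  proof (intro subset_antisym subsetI)
    fix x assume "x \<in> coset r d g i q"
    then obtain m where "x = q \<circ> act r d g i m" by (auto simp: coset_def)
    then show "x \<in> coset r d g i p" using comp_act_in_coset[OF assms(2)] by (simp only: q)
  next
    fix x assume "x \<in> coset r d g i p"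
    then obtain m where m: "x = p \<circ> act r d g i m" by (auto simp: coset_def)
    show "x \<in> coset r d g i q" unfolding m p by (rule comp_act_in_coset[OF assms(2)])
  qed
qed

text \<open>After cancelling the injective \<open>p\<close>, evaluation at the empty word yields
  \<open>push i k []\<close>, from which the exponent and, if it is nonzero, the generator can be
  read off.\<close>

lemma comp_act_inject:
  assumes "p \<in> perms r d g" "i < d" "j < d" "k < r" "m < r" "0 < g"
    and "p \<circ> act r d g i k = p \<circ> act r d g j m"
  shows "k = m" "k \<noteq> 0 \<Longrightarrow> i = j"
proof -
  have "inj p" using assms(1) permutes_inj by (auto simp: perms_def)
  then have "act r d g i k [] = act r d g j m []"
    using fun_cong[OF assms(7), of "[]"] by (simp add: inj_eq)
  then have "push i k [] = push j m []"
    using act_push[of "[]" r d g i 0 k] act_push[of "[]" r d g j 0 m] assms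
    by (simp add: starts_def push_def)
  then show "k = m" "k \<noteq> 0 \<Longrightarrow> i = j"
    by (auto simp: push_def split: if_splits)
qed

text \<open>Each step multiplies on the right by a nontrivial power of a generator, and adjacent
  steps use different generators because their edges differ. So the walk spells a reduced word
  \<open>w\<close>, and the product of its letters sends \<open>[]\<close> to \<open>w\<close>. The
  clause on \<open>e 0\<close> carries the generator of the first step through the induction, so
  that the letter put in front is known to differ from it.\<close>

lemma nbwalk_cosets_word:
  assumes "nbwalk (cosets r d g) m x e" "m \<le> g" "0 < r"
  shows "\<exists>w\<in>words r d g. length w = m \<and> x 0 w = x m [] \<and>
           (0 < m \<longrightarrow> e 0 = coset r d g (fst (hd w)) (x 0))"
  using assms(1,2)
proof (induction m arbitrary: x e)
  case 0
  show ?case by (rule bexI[of _ "[]"]) auto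
next
  case (Suc m)
  have "nbwalk (cosets r d g) m (\<lambda>t. x (Suc t)) (\<lambda>t. e (Suc t))"
    using Suc.prems(1) by (auto simp: nbwalk_def)
  from Suc.IH[OF this] Suc.prems(2) obtain w where w: "w \<in> words r d g" "length w = m"
    "x 1 w = x (Suc m) []" "0 < m \<Longrightarrow> e 1 = coset r d g (fst (hd w)) (x 1)"
    by auto
  have e0: "e 0 \<in> cosets r d g" "x 0 \<in> e 0" "x 1 \<in> e 0" "x 0 \<noteq> x 1"
    using Suc.prems(1) by (auto simp: nbwalk_def)
  then obtain i p where i: "i < d" "e 0 = coset r d g i p" by (auto simp: cosets_def)
  then have e0x: "e 0 = coset r d g i (x 0)" "e 0 = coset r d g i (x 1)"
    using coset_eqI[OF i(1) assms(3)] e0 by auto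
  then obtain k where k: "k < r" "x 1 = x 0 \<circ> act r d g i k"
    using e0(3) by (auto simp: coset_def)
  have "k \<noteq> 0"
  proof
    assume "k = 0"
    then have "x 1 = x 0" using k(2) act_0[OF assms(3)] by (simp add: fun_eq_iff)
    then show False using e0(4) by simp
  qed
  moreover have "\<not> starts i w"
  proof
    assume s: "starts i w"
    then have "0 < m" "fst (hd w) = i" using w(2) by (auto simp: starts_def)
    then have "e 1 = e 0" using w(4) e0x(2) by simp
    then show False using Suc.prems(1) \<open>0 < m\<close> by (auto simp: nbwalk_def)
  qed
  ultimately have act: "act r d g i k w = (i, k) # w"
    using act_Cons w(1,2) i(1) k(1) Suc.prems(2) by auto
  have "(i, k) # w \<in> words r d g"
    using act act_in_words[OF i(1) assms(3) w(1), of k] by simp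
  moreover have "x 0 ((i, k) # w) = x (Suc m) []"
    using w(3) k(2) act by simp
  ultimately show ?case
    using w(2) e0x(1) by (intro bexI[of _ "(i, k) # w"]) auto
qed

lemma admissible_cosets:
  assumes "2 \<le> r" "0 < g"
  shows "admissible r d g (perms r d g, cosets r d g)"
proof -
  have r: "0 < r" using assms(1) by simp
  have "id \<in> perms r d g" by (simp add: perms_def)
  moreover have fin: "finite (perms r d g)"
    using finite_permutations[OF finite_words] by (simp add: perms_def)
  moreover have sub: "cosets r d g \<subseteq> Pow (perms r d g)"
    unfolding cosets_def using coset_subset_perms[OF _ r] by blast
  ultimately have hyp: "hypergraph (perms r d g, cosets r d g)"
    by (auto simp: hypergraph_def)
  have "card (coset r d g i p) = r" if "i < d" "p \<in> perms r d g" for i p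
  proof -
    have "inj_on (\<lambda>k. p \<circ> act r d g i k) {..<r}"
      by (rule inj_onI) (use comp_act_inject(1)[OF that(2,1,1) _ _ assms(2)] in auto)
    then show ?thesis by (simp add: coset_def card_image)
  qed
  then have uni: "uniform_hypergraph r (perms r d g, cosets r d g)"
    by (auto simp: uniform_hypergraph_def cosets_def)
  have "card {e \<in> cosets r d g. p \<in> e} = d" if p: "p \<in> perms r d g" for p
  proof -
    have "{e \<in> cosets r d g. p \<in> e} = (\<lambda>i. coset r d g i p) ` {..<d}"
    proof (intro subset_antisym subsetI)
      fix e assume "e \<in> {e \<in> cosets r d g. p \<in> e}"
      then obtain i q where "i < d" "e = coset r d g i q" "p \<in> e"
        by (auto simp: cosets_def)
      then have "e = coset r d g i p" using coset_eqI[OF _ r] by blast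
      then show "e \<in> (\<lambda>i. coset r d g i p) ` {..<d}" using \<open>i < d\<close> by blast
    qed (use p self_in_coset[OF r] in \<open>auto simp: cosets_def\<close>)
    moreover have "inj_on (\<lambda>i. coset r d g i p) {..<d}"
    proof (rule inj_onI)
      fix i j assume ij: "i \<in> {..<d}" "j \<in> {..<d}" "coset r d g i p = coset r d g j p"
      then have "p \<circ> act r d g i 1 \<in> coset r d g j p"
        using comp_act_in_coset[OF r, of p d g i 1] by simp
      then obtain m where "m < r" "p \<circ> act r d g i 1 = p \<circ> act r d g j m"
        by (auto simp: coset_def)
      then show "i = j"
        using comp_act_inject(2)[OF p, of i j 1 m] ij assms by auto
    qed
    ultimately show ?thesis by (simp add: card_image)
  qed
  then have reg: "regular_hypergraph d (perms r d g, cosets r d g)"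
    by (simp add: regular_hypergraph_def)
  have "enat g \<le> girth (perms r d g, cosets r d g)"
  proof (rule girth_geI[OF hyp])
    fix m x e assume W: "nbwalk (hedges (perms r d g, cosets r d g)) m x e" "0 < m" "x m = x 0"
    show "g \<le> m"
    proof (rule ccontr)
      assume "\<not> g \<le> m"
      \<comment> \<open>A closed walk of length \<open>m < g\<close> makes the injective
        \<open>x 0\<close> agree on \<open>[]\<close> and on the nonempty \<open>w\<close>.\<close>
      then obtain w where w: "length w = m" "x 0 w = x 0 []"
        using nbwalk_cosets_word[of r d g m x e] W r by auto
      have "x 0 \<in> e 0" "e 0 \<in> cosets r d g" using W by (auto simp: nbwalk_def)
      then have "inj (x 0)" using sub permutes_inj by (auto simp: perms_def)
      then show False using w W(2) by (auto dest: injD)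
    qed
  qed
  then show ?thesis using hyp uni reg by (simp add: admissible_def)
qed

lemma ex_admissible_nat:
  assumes "2 \<le> r" "0 < g"
  shows "\<exists>H :: nat hypergraph. admissible r d g H"
proof -
  have "finite (perms r d g)"
    using admissible_cosets[OF assms, of d] by (simp add: admissible_def hypergraph_def)
  then obtain f :: "_ \<Rightarrow> nat" where "inj_on f (perms r d g)"
    using finite_imp_inj_to_nat_seg by metis
  then have "admissible r d g (f ` perms r d g, (`) f ` cosets r d g)"
    using admissible_image[OF admissible_cosets[OF assms, of d], of f] by simp
  then show ?thesis by blast
qed

section \<open>Balls\<close>

text \<open>Distance at most \<open>k\<close>. The reflexive pairs let the \<open>k\<close>-fold
  power include shorter connections.\<close>

definition near :: "'a set set \<Rightarrow> nat \<Rightarrow> ('a \<times> 'a) set" where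
  "near E k = {(x, y). x = y \<or> (\<exists>e\<in>E. x \<in> e \<and> y \<in> e)} ^^ k"

lemma near_0 [simp]: "(x, y) \<in> near E 0 \<longleftrightarrow> x = y"
  by (simp add: near_def)

lemma near_Suc: "(x, y) \<in> near E (Suc k) \<longleftrightarrow>
    (x, y) \<in> near E k \<or> (\<exists>u. (x, u) \<in> near E k \<and> (\<exists>e\<in>E. u \<in> e \<and> y \<in> e))"
  by (auto simp: near_def)

lemma near_edge: "e \<in> E \<Longrightarrow> x \<in> e \<Longrightarrow> y \<in> e \<Longrightarrow> (x, y) \<in> near E 1"
  by (auto simp: near_def)

lemma near_trans:
  assumes "(x, y) \<in> near E k" "(y, z) \<in> near E m"
  shows "(x, z) \<in> near E (k + m)"
  using assms unfolding near_def relpow_add by blast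

lemma near_sym:
  assumes "(x, y) \<in> near E k"
  shows "(y, x) \<in> near E k"
  using assms
proof (induction k arbitrary: y)
  case (Suc k)
  then obtain u where u: "(u, x) \<in> near E k" "(y, u) \<in> near E 1"
    unfolding near_Suc near_def by auto
  show ?case using near_trans[OF u(2,1)] by simp
qed simp

lemma near_mono:
  assumes "(x, y) \<in> near E k" "k \<le> m"
  shows "(x, y) \<in> near E m"
  using assms(2,1) by (induction rule: dec_induct) (auto simp: near_Suc)

lemma nbwalk_near:
  assumes "nbwalk E m x e"
  shows "(x 0, x m) \<in> near E m"
  using assms
proof (induction m)
  case (Suc m)
  then have "nbwalk E m x e" "e m \<in> E" "x m \<in> e m" "x (Suc m) \<in> e m"
    by (auto simp: nbwalk_def)
  then show ?case using Suc.IH by (auto simp: near_Suc)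
qed simp

lemma nbwalk_Cons:
  assumes "nbwalk E n x e" "a \<in> E" "y \<in> a" "x 0 \<in> a" "y \<noteq> x 0" "0 < n \<Longrightarrow> a \<noteq> e 0"
  shows "nbwalk E (Suc n) (case_nat y x) (case_nat a e)"
  using assms by (auto simp: nbwalk_def less_Suc_eq_0_disj split: nat.splits)

lemma nbwalk_snoc:
  assumes "nbwalk E n x e" "a \<in> E" "x n \<in> a" "y \<in> a" "x n \<noteq> y" "0 < n \<Longrightarrow> e (n - 1) \<noteq> a"
  shows "nbwalk E (Suc n) (x(Suc n := y)) (e(n := a))"
proof (cases n)
  case 0
  then show ?thesis using assms by (simp add: nbwalk_def)
next
  case (Suc k)
  then have "e k \<noteq> a" using assms(6) by simp
  then show ?thesis using assms(1-5) Suc by (auto simp: nbwalk_def less_Suc_eq)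
qed

lemma card_UN_le_mult:
  assumes "finite A" "\<And>x. x \<in> A \<Longrightarrow> card (f x) \<le> c"
  shows "card (\<Union>x\<in>A. f x) \<le> card A * c"
  using card_UN_le[OF assms(1), of f] sum_bounded_above[of A "\<lambda>x. card (f x)" c] assms(2)
  by simp

locale regular_uniform =
  fixes V :: "'a set" and E :: "'a set set" and r d :: nat
  assumes finite_V: "finite V"
    and edges_sub: "E \<subseteq> Pow V"
    and card_edge: "\<And>e. e \<in> E \<Longrightarrow> card e = r"
    and degree: "\<And>v. v \<in> V \<Longrightarrow> card {e\<in>E. v \<in> e} = d"
begin

lemma finite_E: "finite E"
  using finite_subset[OF edges_sub] finite_V by simp

lemma near_in_V: "(x, y) \<in> near E k \<Longrightarrow> x \<in> V \<Longrightarrow> y \<in> V"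
  using edges_sub by (induction k arbitrary: y) (auto simp: near_Suc)

text \<open>The vertices at distance exactly \<open>k + 1\<close>. The shift excludes the centre, so
  every vertex of a sphere has an edge leading back.\<close>

definition sphere :: "'a \<Rightarrow> nat \<Rightarrow> 'a set" where
  "sphere x k = near E (Suc k) `` {x} - near E k `` {x}"

lemma sphere_sub: "x \<in> V \<Longrightarrow> sphere x k \<subseteq> V"
  using near_in_V by (auto simp: sphere_def)

text \<open>Each \<open>u\<close> on the sphere has an edge \<open>f u\<close> reaching back to
  distance at most \<open>k\<close>, and such an edge contains no vertex of the next sphere. Only
  the other \<open>d - 1\<close> edges at \<open>u\<close> lead outwards, each to at most
  \<open>r - 1\<close> new vertices.\<close>

lemma card_sphere_Suc:
  assumes "x \<in> V"
  shows "card (sphere x (Suc k)) \<le> card (sphere x k) * ((d - 1) * (r - 1))"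
proof -
  have "\<exists>f\<in>E. u \<in> f \<and> (\<exists>y\<in>f. (x, y) \<in> near E k)" if "u \<in> sphere x k" for u
    using that by (auto simp: sphere_def near_Suc)
  then obtain f where f: "\<And>u. u \<in> sphere x k \<Longrightarrow> f u \<in> E \<and> u \<in> f u \<and> (\<exists>y\<in>f u. (x, y) \<in> near E k)"
    by metis
  have fin: "finite (sphere x k)"
    using finite_subset[OF sphere_sub[OF assms] finite_V] .
  have "sphere x (Suc k) \<subseteq> (\<Union>u\<in>sphere x k. \<Union>e\<in>{e\<in>E. u \<in> e} - {f u}. e - {u})"
  proof
    fix y assume y: "y \<in> sphere x (Suc k)"
    then obtain u e where e: "e \<in> E" "u \<in> e" "y \<in> e" "(x, u) \<in> near E (Suc k)"
      by (auto simp: sphere_def near_Suc[of _ _ _ "Suc k"])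
    have far: "(x, y) \<notin> near E (Suc k)" using y by (simp add: sphere_def)
    then have "(x, w) \<notin> near E k" if "w \<in> e" for w
      using e(1,3) that near_Suc[of x y E k] by blast
    moreover from this have "u \<in> sphere x k" using e by (auto simp: sphere_def)
    moreover from calculation have "e \<noteq> f u" using f by blast
    moreover have "y \<noteq> u" using far e(4) by blast
    ultimately show "y \<in> (\<Union>u\<in>sphere x k. \<Union>e\<in>{e\<in>E. u \<in> e} - {f u}. e - {u})"
      using e by blast
  qed
  moreover have "finite (\<Union>u\<in>sphere x k. \<Union>e\<in>{e\<in>E. u \<in> e} - {f u}. e - {u})"
    using edges_sub by (intro finite_subset[OF _ finite_V]) auto
  ultimately have "card (sphere x (Suc k)) \<le>
      card (\<Union>u\<in>sphere x k. \<Union>e\<in>{e\<in>E. u \<in> e} - {f u}. e - {u})"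
    by (rule card_mono[rotated])
  also have "\<dots> \<le> card (sphere x k) * ((d - 1) * (r - 1))"
  proof (rule card_UN_le_mult[OF fin])
    fix u assume u: "u \<in> sphere x k"
    then have "card ({e\<in>E. u \<in> e} - {f u}) = d - 1"
      using f degree sphere_sub[OF assms] by auto
    moreover have "card (\<Union>e\<in>{e\<in>E. u \<in> e} - {f u}. e - {u}) \<le> card ({e\<in>E. u \<in> e} - {f u}) * (r - 1)"
      using finite_E by (intro card_UN_le_mult) (auto simp: card_edge)
    ultimately show "card (\<Union>e\<in>{e\<in>E. u \<in> e} - {f u}. e - {u}) \<le> (d - 1) * (r - 1)"
      by simp
  qed
  finally show ?thesis .
qed

lemma card_sphere:
  assumes "x \<in> V"
  shows "card (sphere x k) \<le> d * (r - 1) * ((d - 1) * (r - 1)) ^ k"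
proof (induction k)
  case 0
  have "sphere x 0 \<subseteq> (\<Union>e\<in>{e\<in>E. x \<in> e}. e - {x})"
    by (auto simp: sphere_def near_Suc)
  moreover have "finite (\<Union>e\<in>{e\<in>E. x \<in> e}. e - {x})"
    using edges_sub by (intro finite_subset[OF _ finite_V]) auto
  ultimately have "card (sphere x 0) \<le> card (\<Union>e\<in>{e\<in>E. x \<in> e}. e - {x})"
    by (rule card_mono[rotated])
  also have "\<dots> \<le> card {e\<in>E. x \<in> e} * (r - 1)"
    using finite_E by (intro card_UN_le_mult) (auto simp: card_edge)
  finally show ?case using degree[OF assms] by simp
next
  case (Suc k)
  have "card (sphere x k) * ((d - 1) * (r - 1)) \<le>
      d * (r - 1) * ((d - 1) * (r - 1)) ^ k * ((d - 1) * (r - 1))"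
    using Suc by (rule mult_le_mono1)
  also have "\<dots> = d * (r - 1) * ((d - 1) * (r - 1)) ^ Suc k"
    by (simp only: power_Suc2 mult.assoc)
  finally show ?case using card_sphere_Suc[OF assms, of k] by (rule order_trans[rotated])
qed

lemma card_ball:
  assumes "x \<in> V"
  shows "card (near E k `` {x}) \<le> 1 + d * (r - 1) * (\<Sum>i<k. ((d - 1) * (r - 1)) ^ i)"
proof (induction k)
  case 0
  have "near E 0 `` {x} = {x}" by auto
  then show ?case by simp
next
  case (Suc k)
  have "near E (Suc k) `` {x} = near E k `` {x} \<union> sphere x k"
    by (auto simp: sphere_def near_Suc)
  then have "card (near E (Suc k) `` {x}) \<le> card (near E k `` {x}) + card (sphere x k)"
    by (simp add: card_Un_le)
  then show ?case using Suc card_sphere[OF assms, of k] by (simp add: distrib_left)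
qed

text \<open>Greedy choice: while fewer than \<open>r\<close> vertices are chosen, the balls of
  radius \<open>g\<close> around them do not cover \<open>V\<close>.\<close>

lemma ex_far_vertices:
  assumes "(r - 1) * (1 + d * (r - 1) * (\<Sum>i<g. ((d - 1) * (r - 1)) ^ i)) < card V"
  shows "\<exists>Z\<subseteq>V. card Z = r \<and> (\<forall>z\<in>Z. \<forall>z'\<in>Z. (z, z') \<in> near E g \<longrightarrow> z = z')"
proof -
  define B where "B = 1 + d * (r - 1) * (\<Sum>i<g. ((d - 1) * (r - 1)) ^ i)"
  have "\<exists>Z\<subseteq>V. card Z = k \<and> (\<forall>z\<in>Z. \<forall>z'\<in>Z. (z, z') \<in> near E g \<longrightarrow> z = z')" if "k \<le> r" for k
    using that
  proof (induction k)
    case (Suc k)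
    then obtain Z where Z: "Z \<subseteq> V" "card Z = k" "\<forall>z\<in>Z. \<forall>z'\<in>Z. (z, z') \<in> near E g \<longrightarrow> z = z'"
      by auto
    have fin: "finite Z" using finite_subset[OF Z(1) finite_V] .
    have "card (\<Union>z\<in>Z. near E g `` {z}) \<le> card Z * B"
      using Z(1) card_ball[of _ g] unfolding B_def by (intro card_UN_le_mult fin) auto
    also have "\<dots> \<le> (r - 1) * B" using Z(2) Suc.prems by (intro mult_le_mono1) simp
    also have "\<dots> < card V" using assms by (simp add: B_def)
    finally have less: "card (\<Union>z\<in>Z. near E g `` {z}) < card V" .
    have "finite (\<Union>z\<in>Z. near E g `` {z})"
      using Z(1) near_in_V by (intro finite_subset[OF _ finite_V]) auto
    then have "\<not> V \<subseteq> (\<Union>z\<in>Z. near E g `` {z})"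
      using less card_mono leD by blast
    then obtain y where y: "y \<in> V" "\<And>z. z \<in> Z \<Longrightarrow> (z, y) \<notin> near E g" by auto
    then have "y \<notin> Z" using near_mono[of y y E 0 g] by auto
    moreover have "(y, z) \<notin> near E g" if "z \<in> Z" for z using y(2)[OF that] near_sym by metis
    ultimately show ?case
      using Z y fin by (intro exI[of _ "insert y Z"]) auto
  qed auto
  then show ?thesis by blast
qed

end

section \<open>Removing far apart vertices\<close>

locale regular_uniform_girth = regular_uniform +
  fixes g :: nat
  assumes girth_ge: "\<And>m x e. nbwalk E m x e \<Longrightarrow> 0 < m \<Longrightarrow> x m = x 0 \<Longrightarrow> g \<le> m"
    and g_ge: "3 \<le> g" and r_ge: "3 \<le> r" and d_ge: "2 \<le> d"
begin

text \<open>Two different edges sharing two vertices would form a closed walk of length 2, which is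
  below \<open>g\<close>.\<close>

lemma linear:
  assumes "e \<in> E" "f \<in> E" "x \<in> e" "x \<in> f" "y \<in> e" "y \<in> f" "x \<noteq> y"
  shows "e = f"
proof (rule ccontr)
  assume "e \<noteq> f"
  then have "nbwalk E 2 (\<lambda>i. if i = 1 then y else x) (\<lambda>i. if i = 0 then e else f)"
    using assms by (auto simp: nbwalk_def less_2_cases_iff)
  from girth_ge[OF this] g_ge show False by simp
qed

definition nbrs :: "'a \<Rightarrow> 'a set" where
  "nbrs z = (\<Union>e\<in>{e\<in>E. z \<in> e}. e - {z})"

lemma in_nbrs_iff: "y \<in> nbrs z \<longleftrightarrow> y \<noteq> z \<and> (\<exists>e\<in>E. z \<in> e \<and> y \<in> e)"
  by (auto simp: nbrs_def)

lemma nbrs_near: "y \<in> nbrs z \<Longrightarrow> (z, y) \<in> near E 1"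
  using near_edge by (auto simp: in_nbrs_iff)

text \<open>By \<open>linear\<close>, the edges through \<open>z\<close> are disjoint apart from
  \<open>z\<close>.\<close>

lemma card_nbrs:
  assumes "z \<in> V"
  shows "card (nbrs z) = d * (r - 1)"
proof -
  have "card (nbrs z) = (\<Sum>e\<in>{e\<in>E. z \<in> e}. card (e - {z}))"
    unfolding nbrs_def
  proof (rule card_UN_disjoint)
    show "\<forall>e\<in>{e\<in>E. z \<in> e}. finite (e - {z})"
      using edges_sub finite_subset[OF _ finite_V] by auto
    show "\<forall>e\<in>{e\<in>E. z \<in> e}. \<forall>f\<in>{e\<in>E. z \<in> e}. e \<noteq> f \<longrightarrow> (e - {z}) \<inter> (f - {z}) = {}"
      using linear by blast
  qed (simp add: finite_E)
  also have "\<dots> = (\<Sum>e\<in>{e\<in>E. z \<in> e}. r - 1)"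
    by (intro sum.cong) (auto simp: card_edge)
  finally show ?thesis using degree[OF assms] by simp
qed

text \<open>Enumerate the \<open>M\<close> neighbours of every deleted vertex; the new edge
  \<open>F k\<close> collects all the \<open>k\<close>-th neighbours. Its size is \<open>r\<close>
  because \<open>r\<close> vertices are deleted. Each neighbour loses exactly one edge and gains
  exactly one.\<close>

lemma remove_far_vertices:
  assumes Z_sub: "Z \<subseteq> V" and card_Z: "card Z = r"
    and far: "\<And>z z'. z \<in> Z \<Longrightarrow> z' \<in> Z \<Longrightarrow> (z, z') \<in> near E g \<Longrightarrow> z = z'"
  shows "\<exists>E'. admissible r d g (V - Z, E')"
proof -
  define M where "M = d * (r - 1)"
  have far': "z = z'" if "z \<in> Z" "z' \<in> Z" "(z, z') \<in> near E k" "k \<le> g" for z z' k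
    using far[OF that(1,2) near_mono[OF that(3,4)]] .
  have fin_Z: "finite Z" using finite_subset[OF Z_sub finite_V] .
  have nbrs_unique: "z = z'" if "z \<in> Z" "z' \<in> Z" "y \<in> nbrs z" "y \<in> nbrs z'" for z z' y
    using far'[OF that(1,2) near_trans[OF nbrs_near[OF that(3)] near_sym[OF nbrs_near[OF that(4)]]]] g_ge
    by simp
  have nbrs_sub: "nbrs z \<subseteq> V - Z" if "z \<in> Z" for z
  proof
    fix y assume y: "y \<in> nbrs z"
    then have "y \<notin> Z"
      using far'[OF that _ nbrs_near[OF y]] g_ge by (auto simp: in_nbrs_iff)
    then show "y \<in> V - Z" using y edges_sub by (auto simp: in_nbrs_iff)
  qed
  have "\<forall>z\<in>Z. \<exists>h. bij_betw h {..<M} (nbrs z)"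
  proof
    fix z assume z: "z \<in> Z"
    then have "finite (nbrs z)" using nbrs_sub finite_subset[OF _ finite_V] by blast
    moreover have "card (nbrs z) = M" using card_nbrs z Z_sub by (auto simp: M_def)
    ultimately show "\<exists>h. bij_betw h {..<M} (nbrs z)"
      using ex_bij_betw_nat_finite[of "nbrs z"] by (simp add: atLeast0LessThan)
  qed
  then obtain h where h: "\<And>z. z \<in> Z \<Longrightarrow> bij_betw (h z) {..<M} (nbrs z)"
    by metis
  have h_in: "h z k \<in> nbrs z" if "z \<in> Z" "k < M" for z k
    using h[OF that(1)] that(2) by (auto simp: bij_betw_def)
  define F where "F k = (\<lambda>z. h z k) ` Z" for k
  \<comment> \<open>A new edge contains exactly one neighbour of each deleted vertex.\<close>
  have F_nbrs: "y = h z k" if "k < M" "y \<in> F k" "z \<in> Z" "y \<in> nbrs z" for y z k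
    using that h_in nbrs_unique unfolding F_def by blast
  have F_disjoint: "k = k'" if y: "k < M" "k' < M" "y \<in> F k" "y \<in> F k'" for k k' y
  proof -
    obtain z where z: "z \<in> Z" "y = h z k" using y(3) by (auto simp: F_def)
    then have "h z k = h z k'" using F_nbrs[OF y(2,4) z(1)] h_in[OF z(1) y(1)] by simp
    then show ?thesis using h[OF z(1)] y(1,2) by (auto simp: bij_betw_def dest: inj_onD)
  qed
  have card_F: "card (F k) = r" if "k < M" for k
  proof -
    have "inj_on (\<lambda>z. h z k) Z"
      using h_in[OF _ that] nbrs_unique by (intro inj_onI) metis
    then show ?thesis by (simp add: F_def card_image card_Z)
  qed
  have F_sub: "F k \<subseteq> V - Z" if "k < M" for k
    using h_in[OF _ that] nbrs_sub unfolding F_def by blast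
  \<comment> \<open>The edges form a set, so a new edge that was already present would not raise any
    degree. It would also join two deleted vertices by a path of length 3, which is at most
    \<open>g\<close>.\<close>
  have F_notin_E: "F k \<notin> E" if "k < M" for k
  proof
    assume "F k \<in> E"
    have "\<not> card Z \<le> Suc 0" using card_Z r_ge by simp
    then obtain z z' where z: "z \<in> Z" "z' \<in> Z" "z \<noteq> z'"
      using card_le_Suc0_iff_eq[OF fin_Z] by auto
    then have "(h z k, h z' k) \<in> near E 1"
      using \<open>F k \<in> E\<close> by (intro near_edge) (auto simp: F_def)
    then have "(z, z') \<in> near E (1 + 1 + 1)"
      using near_trans[OF near_trans[OF nbrs_near[OF h_in[OF z(1) that]]]
          near_sym[OF nbrs_near[OF h_in[OF z(2) that]]]] by blast
    from far'[OF z(1,2) this] show False using z(3) g_ge by simp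
  qed
  define K where "K = {e\<in>E. e \<inter> Z = {}}"
  define E' where "E' = K \<union> F ` {..<M}"
  have M_pos: "0 < M" using d_ge r_ge by (simp add: M_def)
  obtain z0 where z0: "z0 \<in> Z" using card_Z r_ge by fastforce
  have "V - Z \<noteq> {}" using h_in[OF z0 M_pos] nbrs_sub[OF z0] by blast
  moreover have "E' \<subseteq> Pow (V - Z)"
    using F_sub edges_sub by (auto simp: E'_def K_def)
  ultimately have hyp: "hypergraph (V - Z, E')"
    using finite_V by (simp add: hypergraph_def)
  have uni: "uniform_hypergraph r (V - Z, E')"
    using card_edge card_F by (auto simp: uniform_hypergraph_def E'_def K_def)
  have "card {e\<in>E'. v \<in> e} = d" if v: "v \<in> V - Z" for v
  proof (cases "\<exists>z\<in>Z. v \<in> nbrs z")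
    case True
    then obtain z where z: "z \<in> Z" "v \<in> nbrs z" by blast
    then obtain e0 where e0: "e0 \<in> E" "z \<in> e0" "v \<in> e0" by (auto simp: in_nbrs_iff)
    obtain k where k: "k < M" "v = h z k"
      using h[OF z(1)] z(2) by (auto simp: bij_betw_def)
    \<comment> \<open>Only \<open>e0\<close> is lost at \<open>v\<close>: another deleted edge
      through \<open>v\<close> would also contain \<open>z\<close>, against
      \<open>linear\<close>.\<close>
    have 1: "{e\<in>K. v \<in> e} = {e\<in>E. v \<in> e} - {e0}"
    proof -
      have "e \<inter> Z = {}" if e: "e \<in> E" "v \<in> e" "e \<noteq> e0" for e
      proof (rule ccontr)
        assume "e \<inter> Z \<noteq> {}"
        then obtain z' where z': "z' \<in> e" "z' \<in> Z" by blast
        then have "v \<in> nbrs z'" using e v by (auto simp: in_nbrs_iff)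
        then have "z' = z" using nbrs_unique z z' by blast
        then show False using linear[OF e(1) e0(1)] e e0 z z' v by blast
      qed
      then show ?thesis using e0 z(1) by (auto simp: K_def)
    qed
    have 2: "{e\<in>F ` {..<M}. v \<in> e} = {F k}"
    proof -
      have "v \<in> F k" using z(1) k(2) by (auto simp: F_def)
      then show ?thesis using F_disjoint[OF k(1)] k(1) by blast
    qed
    have "{e\<in>E'. v \<in> e} = insert (F k) ({e\<in>E. v \<in> e} - {e0})"
      using 1 2 unfolding E'_def by blast
    moreover have "F k \<notin> {e\<in>E. v \<in> e} - {e0}" using F_notin_E[OF k(1)] by simp
    moreover have "card ({e\<in>E. v \<in> e} - {e0}) = d - 1"
      using degree v e0 by simp
    ultimately show ?thesis using finite_E d_ge by simp
  next
    case False
    then have "{e\<in>E'. v \<in> e} = {e\<in>E. v \<in> e}"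
      using v h_in unfolding E'_def K_def F_def by (fastforce simp: in_nbrs_iff)
    then show ?thesis using degree v by simp
  qed
  then have reg: "regular_hypergraph d (V - Z, E')"
    by (simp add: regular_hypergraph_def)
  have F_start: "g \<le> l" if C: "cycle E' l e v" and e0: "e 0 = F a" and a: "a < M" for l e v a
  proof -
    have l: "2 \<le> l" and inj_e: "inj_on e {..<l}" and inj_v: "inj_on v {..<l}"
      and v: "\<And>i. i < l \<Longrightarrow> v i \<in> e i" "\<And>i. i < l \<Longrightarrow> v i \<in> e (Suc i mod l)"
      and eE': "\<And>i. i < l \<Longrightarrow> e i \<in> E'"
      using C by (auto simp: cycle_def)
    \<comment> \<open>The next new edge after \<open>e 0\<close>. If \<open>e 0\<close> is the only
      one, then \<open>j = l\<close> and the search comes back to it.\<close>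
    define j where "j = (LEAST j. 1 \<le> j \<and> e (j mod l) \<in> F ` {..<M})"
    have ex: "1 \<le> l \<and> e (l mod l) \<in> F ` {..<M}" using l e0 a by auto
    have j: "1 \<le> j" "e (j mod l) \<in> F ` {..<M}"
      using LeastI[of "\<lambda>j. 1 \<le> j \<and> e (j mod l) \<in> F ` {..<M}", OF ex] unfolding j_def by auto
    have jl: "j \<le> l"
      using Least_le[of "\<lambda>j. 1 \<le> j \<and> e (j mod l) \<in> F ` {..<M}", OF ex] unfolding j_def by auto
    obtain b where b: "b < M" "e (j mod l) = F b" using j(2) by auto
    have inK: "e i \<in> K" if i: "1 \<le> i" "i < j" for i
    proof -
      have "e (i mod l) \<notin> F ` {..<M}"
        using not_less_Least[of i "\<lambda>j. 1 \<le> j \<and> e (j mod l) \<in> F ` {..<M}"] i unfolding j_def by auto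
      then show ?thesis using eE'[of i] i jl by (simp add: E'_def)
    qed
    have KE: "K \<subseteq> E" by (auto simp: K_def)
    have v0: "v 0 \<in> F a" using v(1)[of 0] l e0 by auto
    have vj: "v (j - 1) \<in> F b" using v(2)[of "j - 1"] j(1) jl b(2) by simp
    obtain z where z: "z \<in> Z" "v 0 = h z a" using v0 by (auto simp: F_def)
    obtain z' where z': "z' \<in> Z" "v (j - 1) = h z' b" using vj by (auto simp: F_def)
    have zn: "v 0 \<in> nbrs z" "v (j - 1) \<in> nbrs z'" using z z' h_in a b by auto
    \<comment> \<open>The stretch of old edges strictly between the two new ones, of length
      \<open>j - 1\<close>, possibly 0.\<close>
    have W: "nbwalk E (j - 1) v (\<lambda>t. e (Suc t))"
      unfolding nbwalk_def
    proof (intro conjI allI impI)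
      fix i assume i: "i < j - 1"
      show "e (Suc i) \<in> E" using inK[of "Suc i"] i KE by auto
      show "v i \<in> e (Suc i)" using v(2)[of i] i jl by simp
      show "v (Suc i) \<in> e (Suc i)" using v(1)[of "Suc i"] i jl by simp
      show "v i \<noteq> v (Suc i)" using inj_onD[OF inj_v, of i "Suc i"] i jl by fastforce
    next
      fix i assume "Suc i < j - 1"
      then have "Suc (Suc i) < l" using jl by linarith
      then show "e (Suc i) \<noteq> e (Suc (Suc i))"
        using inj_onD[OF inj_e, of "Suc i" "Suc (Suc i)"] by auto
    qed
    show "g \<le> l"
    proof (cases "z = z'")
      case False
      \<comment> \<open>Passing through the two neighbours puts \<open>z\<close> and
        \<open>z'\<close> at distance at most \<open>j + 1\<close>. As this must exceed
        \<open>g\<close>, it follows that \<open>g \<le> j\<close>.\<close>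
      have "(z, z') \<in> near E (1 + (j - 1) + 1)"
        using near_trans[OF near_trans[OF nbrs_near[OF zn(1)] nbwalk_near[OF W]]
            near_sym[OF nbrs_near[OF zn(2)]]] .
      then have "\<not> 1 + (j - 1) + 1 \<le> g" using far'[OF z(1) z'(1)] False by blast
      then show ?thesis using j(1) jl by linarith
    next
      case True
      \<comment> \<open>With a single new edge, \<open>v 0\<close> and \<open>v (j - 1)\<close>
        would both be its one neighbour of \<open>z\<close>. The strict inequality
        \<open>j < l\<close> pays for the longer of the two closing walks below.\<close>
      have "j \<noteq> l"
      proof
        assume "j = l"
        then have "F b = F a" using b(2) e0 by simp
        then have "b = a" using F_disjoint[OF b(1) a, of "v 0"] v0 by blast
        then have "v (j - 1) = v 0" using z z' True by simp
        then show False using inj_onD[OF inj_v, of "j - 1" 0] \<open>j = l\<close> l by simp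
      qed
      then have j_less: "j < l" using jl by simp
      then have "F a \<noteq> F b"
        using inj_onD[OF inj_e, of 0 j] j(1) e0 b(2) by auto
      then have "j \<noteq> 1"
        using F_disjoint[OF a b(1) v0] vj by auto
      then have j2: "2 \<le> j" using j(1) by simp
      have vne: "v (j - 1) \<noteq> v 0"
      proof -
        have "j - 1 < l" "j - 1 \<noteq> 0" using j2 jl by linarith+
        then show ?thesis using inj_onD[OF inj_v, of "j - 1" 0] by auto
      qed
      \<comment> \<open>The deleted edges \<open>A\<close> and \<open>B\<close> close the stretch up
        through \<open>z\<close>. They differ from \<open>e 1\<close> and \<open>e (j - 1)\<close>,
        which lie in \<open>K\<close>, so no backtracking occurs.\<close>
      obtain A where A: "A \<in> E" "z \<in> A" "v 0 \<in> A" using zn(1) by (auto simp: in_nbrs_iff)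
      obtain B where B: "B \<in> E" "z \<in> B" "v (j - 1) \<in> B"
        using zn(2) True by (auto simp: in_nbrs_iff)
      have ne: "A \<notin> K" "B \<notin> K" "v 0 \<noteq> z" "v (j - 1) \<noteq> z"
        using A B z(1) zn True by (auto simp: K_def in_nbrs_iff)
      have eK: "e 1 \<in> K" "e (j - 1) \<in> K" using inK[of 1] inK[of "j - 1"] j2 by auto
      moreover have "Suc (j - 1 - 1) = j - 1" using j2 by simp
      ultimately have eB: "e (Suc (j - 1 - 1)) \<noteq> B" using ne(2) by metis
      show ?thesis
      proof (cases "A = B")
        case True
        \<comment> \<open>If one edge contains both ends, it alone closes the walk, without a visit
          to \<open>z\<close>; the length is \<open>j\<close>.\<close>
        have "nbwalk E (Suc (j - 1)) (v(Suc (j - 1) := v 0)) ((\<lambda>t. e (Suc t))(j - 1 := B))"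
        proof (rule nbwalk_snoc[OF W B(1,3) _ vne])
          show "v 0 \<in> B" using A True by simp
        qed (rule eB)
        from girth_ge[OF this] show ?thesis using jl j2 by simp
      next
        case False
        let ?x = "v(Suc (j - 1) := z)" and ?e = "(\<lambda>t. e (Suc t))(j - 1 := B)"
        have W1: "nbwalk E (Suc (j - 1)) ?x ?e"
          by (rule nbwalk_snoc[OF W B(1,3,2) ne(4) eB])
        \<comment> \<open>The closed walk from \<open>z\<close> along \<open>A\<close>, the stretch
          and \<open>B\<close> has length \<open>j + 1\<close>, which is at most
          \<open>l\<close>.\<close>
        have "nbwalk E (Suc (Suc (j - 1))) (case_nat z ?x) (case_nat A ?e)"
        proof (rule nbwalk_Cons[OF W1 A(1,2)])
          show "?x 0 \<in> A" "z \<noteq> ?x 0" using A(3) ne(3) by auto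
          show "A \<noteq> ?e 0" using eK(1) ne(1) j2 by auto
        qed
        from girth_ge[OF this] show ?thesis using j_less j2 by simp
      qed
    qed
  qed
  have "g \<le> l" if C: "cycle E' l e v" for l e v
  proof (cases "\<exists>i<l. e i \<in> F ` {..<M}")
    case True
    then obtain i a where "i < l" "a < M" "e i = F a" by auto
    then show ?thesis using F_start[OF cycle_rotate[OF C, of i], of a] by simp
  next
    case False
    have "e i \<in> E" if "i < l" for i
    proof -
      have "e i \<in> E'" using C that by (auto simp: cycle_def)
      then show ?thesis using False that by (auto simp: E'_def K_def)
    qed
    then have C': "cycle E l e v" using C by (auto simp: cycle_def)
    then have "0 < l" by (simp add: cycle_def)
    then show ?thesis using girth_ge[OF cycle_imp_nbwalk[OF C']] by simp
  qed
  then have "enat g \<le> girth (V - Z, E')"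
    using girth_ge_iff[OF hyp] by (simp only: snd_conv) blast
  then show ?thesis using hyp uni reg by (auto simp: admissible_def)
qed

end

section \<open>The extremal argument and the numerical bound\<close>

lemma admissible_imp_regular_uniform_girth:
  assumes "admissible r d g (V, E)" "3 \<le> g" "3 \<le> r" "2 \<le> d"
  shows "regular_uniform_girth V E r d g"
proof
  have H: "hypergraph (V, E)" "enat g \<le> girth (V, E)" using assms(1) by (simp_all add: admissible_def)
  show "g \<le> m" if "nbwalk E m x e" "0 < m" "x m = x 0" for m x e
    using girth_geD[OF H, of m x e] that by simp
qed (use assms in \<open>auto simp: admissible_def hypergraph_def uniform_hypergraph_def regular_hypergraph_def\<close>)

text \<open>An admissible hypergraph with the fewest vertices obeys the bound; otherwise
  \<open>remove_far_vertices\<close> would produce a smaller one.\<close>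

lemma ex_small_admissible:
  assumes "2 \<le> d" "3 \<le> r" "3 \<le> g"
  shows "\<exists>H :: nat hypergraph. admissible r d g H \<and>
    card (hverts H) \<le> (r - 1) * (1 + d * (r - 1) * (\<Sum>i<g. ((d - 1) * (r - 1)) ^ i))"
proof -
  have "\<exists>H :: nat hypergraph. admissible r d g H" using ex_admissible_nat assms by simp
  then obtain H :: "nat hypergraph" where H: "admissible r d g H"
    and min: "\<And>H' :: nat hypergraph. admissible r d g H' \<Longrightarrow> card (hverts H) \<le> card (hverts H')"
    using ex_has_least_nat[of "admissible r d g" _ "\<lambda>H. card (hverts H)"] by blast
  obtain V E where VE: "H = (V, E)" by (cases H)
  interpret regular_uniform_girth V E r d g
    using admissible_imp_regular_uniform_girth H VE assms by blast
  show ?thesis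
  proof (rule ccontr)
    assume "\<not> ?thesis"
    then have "(r - 1) * (1 + d * (r - 1) * (\<Sum>i<g. ((d - 1) * (r - 1)) ^ i)) < card V"
      using H VE by (auto simp: not_le)
    then obtain Z where Z: "Z \<subseteq> V" "card Z = r" "\<forall>z\<in>Z. \<forall>z'\<in>Z. (z, z') \<in> near E g \<longrightarrow> z = z'"
      using ex_far_vertices by blast
    then obtain E' where "admissible r d g (V - Z, E')"
      using remove_far_vertices[of Z] by blast
    then have "card V \<le> card (V - Z)" using min[of "(V - Z, E')"] VE by simp
    moreover have "card (V - Z) < card V"
    proof -
      have "Z \<noteq> {}" using Z(2) assms(2) by auto
      then show ?thesis using Z(1) by (intro psubset_card_mono[OF finite_V]) blast
    qed
    ultimately show False by simp
  qed
qed

text \<open>Let \<open>D\<close> be the product of \<open>d - 1\<close> and \<open>r - 1\<close>, so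
  \<open>D \<ge> 2\<close>. The first factor is at most \<open>D\<close>, \<open>d\<close> is at
  most twice \<open>d - 1\<close>, and \<open>D\<close> is at most twice \<open>D - 1\<close>, so
  the left side is at most \<open>D * (1 + 4 * (D ^ g - 1))\<close>. This falls short of the right
  side by \<open>3 * D\<close>.\<close>

lemma vertex_bound_less:
  fixes r d g :: nat
  assumes "d \<ge> 2" "r \<ge> 3"
  shows "(real r - 1) * (1 + real d * (real r - 1) *
            (((real d - 1) ^ g * (real r - 1) ^ g - 1) / ((real d - 1) * (real r - 1) - 1)))
           < 4 * ((real d - 1) * (real r - 1)) ^ (g + 1)"
proof -
  define D where "D = (real d - 1) * (real r - 1)"
  define X where "X = (D ^ g - 1) / (D - 1)"
  have rD: "real r - 1 \<le> D"
    using mult_right_mono[of 1 "real d - 1" "real r - 1"] assms by (simp add: D_def)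
  then have D2: "D \<ge> 2" using assms by simp
  have dD: "real d * (real r - 1) \<le> 2 * D"
    using mult_right_mono[of "real d" "2 * (real d - 1)" "real r - 1"] assms by (simp add: D_def)
  have X0: "0 \<le> X" using D2 by (simp add: X_def)
  have "D * X \<le> 2 * (D ^ g - 1)"
  proof -
    have "D * X \<le> 2 * (D - 1) * X"
      using D2 X0 by (intro mult_right_mono) auto
    moreover have "(D - 1) * X = D ^ g - 1" using D2 by (simp add: X_def)
    ultimately show ?thesis by (simp only: mult.assoc)
  qed
  moreover have "real d * (real r - 1) * X \<le> 2 * D * X"
    using dD X0 by (rule mult_right_mono)
  ultimately have "1 + real d * (real r - 1) * X \<le> 1 + 4 * (D ^ g - 1)" by linarith
  then have "(real r - 1) * (1 + real d * (real r - 1) * X) \<le> D * (1 + 4 * (D ^ g - 1))"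
    using rD D2 X0 assms by (intro mult_mono) auto
  also have "\<dots> < 4 * D ^ (g + 1)" using D2 by (simp add: algebra_simps)
  finally show ?thesis by (simp add: X_def D_def power_mult_distrib)
qed

theorem theorem5:
  fixes r d g :: nat
  assumes "d \<ge> 2" and "r \<ge> 3" and "g \<ge> 3"
  shows "(\<exists>H :: nat hypergraph.
            hypergraph H \<and> uniform_hypergraph r H \<and> regular_hypergraph d H \<and> enat g \<le> girth H \<and>
            real (card (hverts H)) \<le>
              (real r - 1) * (1 + real d * (real r - 1) *
                (((real d - 1) ^ g * (real r - 1) ^ g - 1) / ((real d - 1) * (real r - 1) - 1))))
       \<and> (real r - 1) * (1 + real d * (real r - 1) *
            (((real d - 1) ^ g * (real r - 1) ^ g - 1) / ((real d - 1) * (real r - 1) - 1)))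
           < 4 * ((real d - 1) * (real r - 1)) ^ (g + 1)
       \<and> real (min_order r g d) < 4 * ((real d - 1) * (real r - 1)) ^ (g + 1)"
proof -
  obtain H :: "nat hypergraph" where H: "admissible r d g H"
    and card: "card (hverts H) \<le> (r - 1) * (1 + d * (r - 1) * (\<Sum>i<g. ((d - 1) * (r - 1)) ^ i))"
    using ex_small_admissible[OF assms] by blast
  have ne: "(real d - 1) * (real r - 1) \<noteq> 1"
    using mult_mono[of 1 "real d - 1" 2 "real r - 1"] assms by auto
  have "real (card (hverts H)) \<le>
      real ((r - 1) * (1 + d * (r - 1) * (\<Sum>i<g. ((d - 1) * (r - 1)) ^ i)))"
    using card by (simp only: of_nat_le_iff)
  also have "\<dots> = (real r - 1) * (1 + real d * (real r - 1) *
      (\<Sum>i<g. ((real d - 1) * (real r - 1)) ^ i))"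
  proof -
    have "real (r - 1) = real r - 1" "real (d - 1) = real d - 1" using assms by simp_all
    then show ?thesis by (simp only: of_nat_mult of_nat_add of_nat_sum of_nat_power of_nat_1)
  qed
  also have "(\<Sum>i<g. ((real d - 1) * (real r - 1)) ^ i) =
      ((real d - 1) ^ g * (real r - 1) ^ g - 1) / ((real d - 1) * (real r - 1) - 1)"
    using geometric_sum[OF ne, of g] by (simp only: power_mult_distrib)
  finally have le: "real (card (hverts H)) \<le> (real r - 1) * (1 + real d * (real r - 1) *
      (((real d - 1) ^ g * (real r - 1) ^ g - 1) / ((real d - 1) * (real r - 1) - 1)))"
    (is "_ \<le> ?b") .
  have "min_order r g d \<le> card (hverts H)"
    unfolding min_order_def using H by (intro Least_le exI[of _ H]) (simp add: admissible_def)
  then have "real (min_order r g d) \<le> ?b" using le by linarith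
  moreover note vertex_bound_less[OF assms(1,2), of g]
  ultimately show ?thesis
    using le H unfolding admissible_def by (meson le_less_trans)
qed

end
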